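(* Let $\mathfrak{A}$ be a unital $C^*$-algebra and let $x,y\in\mathfrak{A}$. Then the following hold. (i) $$v(x+y)\le \tfrac12\big(v(x)+v(y)\big)+\tfrac12\sqrt{\big(v(x)-v(y)\big)^2+4\sup_{\theta\in\mathbb{R}}\big\|\operatorname{Re}(e^{i\theta}x)\operatorname{Re}(e^{i\theta}y)\big\|}\le v(x)+v(y).$$ (ii) $$v(x+y)\le \tfrac12\big(v(x)+v(y)\big)+\tfrac12\sqrt{\big(v(x)-v(y)\big)^2+4\sup_{\theta\in\mathbb{R}}\big\|\operatorname{Im}(e^{i\theta}x)\operatorname{Im}(e^{i\theta}y)\big\|}\le v(x)+v(y).$$
   Context: $\mathfrak{A}$ is a (nonzero, complex) $C^*$-algebra with unit $e$. For $x\in\mathfrak{A}$, $\operatorname{Re}(x)=\frac12(x+x^* )$ and $\operatorname{Im}(x)=\frac{1}{2i}(x-x^* )$. The set of normalized states is $\mathcal{S}(\mathfrak{A})=\{\varphi\in\mathfrak{A}':\varphi(e)=\|\varphi\|=1\}$, where $\mathfrak{A}'$ is the dual space of $\mathfrak{A}$. The numerical radius of $x$ is $v(x)=\sup\{|\varphi(x)|:\varphi\in\mathcal{S}(\mathfrak{A})\}$. *)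

theory Defs
  imports "HOL-Analysis.Analysis"
begin

text \<open>
  Nonzero complex unital C*-algebras.  The real scalar multiplication inherited from
  \<^class>\<open>banach\<close> is the restriction of the complex one.  The superclass
  \<^class>\<open>real_normed_algebra_1\<close> supplies \<open>1 \<noteq> 0\<close>,
  submultiplicativity of the norm, and \<open>norm 1 = 1\<close>; the last follows from the C*-identity
  in a nonzero algebra, so it is no restriction.
\<close>

class cstar_algebra_1 = real_normed_algebra_1 + banach +
  fixes scaleC :: "complex \<Rightarrow> 'a \<Rightarrow> 'a"  (infixr \<open>*\<^sub>C\<close> 75)
    and star :: "'a \<Rightarrow> 'a"
  assumes scaleC_add_right: "c *\<^sub>C (x + y) = c *\<^sub>C x + c *\<^sub>C y"
    and scaleC_add_left: "(c + d) *\<^sub>C x = c *\<^sub>C x + d *\<^sub>C x"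
    and scaleC_scaleC: "c *\<^sub>C d *\<^sub>C x = (c * d) *\<^sub>C x"
    and scaleC_one: "1 *\<^sub>C x = x"
    and scaleC_of_real: "complex_of_real r *\<^sub>C x = r *\<^sub>R x"
    and mult_scaleC_left: "(c *\<^sub>C x) * y = c *\<^sub>C (x * y)"
    and mult_scaleC_right: "x * (c *\<^sub>C y) = c *\<^sub>C (x * y)"
    and norm_scaleC: "norm (c *\<^sub>C x) = cmod c * norm x"
    and star_star: "star (star x) = x"
    and star_add: "star (x + y) = star x + star y"
    and star_scaleC: "star (c *\<^sub>C x) = cnj c *\<^sub>C star x"
    and star_mult: "star (x * y) = star y * star x"
    and cstar_identity: "norm (star x * x) = (norm x)\<^sup>2"

instantiation complex :: cstar_algebra_1
begin

definition scaleC_complex :: "complex \<Rightarrow> complex \<Rightarrow> complex"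
  where "scaleC_complex c x = c * x"

definition star_complex :: "complex \<Rightarrow> complex"
  where "star_complex x = cnj x"

instance
  by standard
    (auto simp: scaleC_complex_def star_complex_def algebra_simps norm_mult
      scaleR_conv_of_real power2_eq_square)

end

definition Re_part :: "'a::cstar_algebra_1 \<Rightarrow> 'a"
  where "Re_part x = (1 / 2) *\<^sub>C (x + star x)"

definition Im_part :: "'a::cstar_algebra_1 \<Rightarrow> 'a"
  where "Im_part x = (1 / (2 * \<i>)) *\<^sub>C (x - star x)"

text \<open>
  A member of the dual space is a bounded complex-linear functional; \<^const>\<open>onorm\<close> depends
  only on the norms, so for such a functional it is the dual norm.
\<close>

definition dual_space :: "('a::cstar_algebra_1 \<Rightarrow> complex) set"
  where "dual_space = {\<phi>. bounded_linear \<phi> \<and> (\<forall>c x. \<phi> (c *\<^sub>C x) = c * \<phi> x)}"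

definition states :: "('a::cstar_algebra_1 \<Rightarrow> complex) set"
  where "states = {\<phi> \<in> dual_space. \<phi> 1 = 1 \<and> onorm \<phi> = 1}"

text \<open>
  The supremum is taken in \<^typ>\<open>real\<close>; it is a genuine one, since states exist by the
  Hahn-Banach theorem and \<open>cmod (\<phi> x) \<le> norm x\<close> for every state.
\<close>

definition numerical_radius :: "'a::cstar_algebra_1 \<Rightarrow> real"
  where "numerical_radius x = (SUP \<phi>\<in>states. cmod (\<phi> x))"

end

theory Submission
  imports Defs
begin

text \<open>
  The numerical radius is \<open>v x = sup\<^sub>\<theta> \<parallel>Re (exp (i \<theta>) x)\<parallel>\<close>: one inequality
  rotates \<open>\<phi> x\<close> onto the positive axis, the other needs a state norming a self-adjoint element.
  It therefore suffices to bound \<open>\<parallel>a + b\<parallel>\<close> for self-adjoint \<open>a\<close>, \<open>b\<close> by the larger eigenvalue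
  of the real matrix with rows \<open>(\<parallel>a\<parallel>, 1)\<close> and \<open>(\<parallel>b a\<parallel>, \<parallel>b\<parallel>)\<close>, which controls the growth of the
  powers \<open>(a + b)\<^sup>n\<close>, whose norms are exactly \<open>\<parallel>a + b\<parallel>\<^sup>n\<close>.  Part (ii) is part (i) with \<open>\<theta>\<close>
  shifted by \<open>\<pi> / 2\<close>.
\<close>

subsection \<open>Norming functionals\<close>

definition sublinear :: "('a::real_vector \<Rightarrow> real) \<Rightarrow> bool"
  where "sublinear p \<longleftrightarrow> (\<forall>x y. p (x + y) \<le> p x + p y) \<and> (\<forall>t\<ge>0. \<forall>x. p (t *\<^sub>R x) = t * p x)"

lemma sublinear_zero: "sublinear p \<Longrightarrow> p 0 = 0"
  unfolding sublinear_def by (metis mult_zero_left order_refl scaleR_zero_left)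

text \<open>This gives pointwise lower bounds for a whole family: below a fixed \<open>p\<close>,
  every sublinear \<open>q\<close> satisfies \<open>- p (- x) \<le> q x\<close>, so infima over such
  families are genuine.\<close>

lemma sublinear_ge_neg:
  assumes "sublinear p"
  shows "- p (- x) \<le> p x"
proof -
  have "p (x + - x) \<le> p x + p (- x)"
    using assms unfolding sublinear_def by blast
  then show ?thesis
    using sublinear_zero[OF assms] by simp
qed

lemma cINF_mult_left:
  fixes f :: "'i \<Rightarrow> real"
  assumes "I \<noteq> {}" "bdd_below (f ` I)" "0 < t"
  shows "(INF i\<in>I. t * f i) = t * (INF i\<in>I. f i)"
proof -
  have "t * (INF i\<in>I. f i) = (INF i\<in>I. t * f i)"
  proof -
    have "continuous (at_right (Inf (f ` I))) (\<lambda>x. t * x)"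
      by (intro continuous_intros)
    moreover have "mono (\<lambda>x. t * x)"
      using assms(3) by (simp add: mono_def)
    ultimately show ?thesis
      using continuous_at_Inf_mono[of "\<lambda>x. t * x" "f ` I"] assms by (simp add: image_image)
  qed
  then show ?thesis ..
qed

text \<open>One criterion serves both infima formed below, over a ray of parameters and over a
  chain. The index \<open>k\<close> may depend on \<open>i\<close>, \<open>j\<close>,
  \<open>x\<close> and \<open>y\<close>, so a near-optimal choice for \<open>x\<close> and one for
  \<open>y\<close> combine into a choice for \<open>x + y\<close>.\<close>

lemma sublinear_INF:
  fixes q :: "'i \<Rightarrow> 'a::real_vector \<Rightarrow> real"
  assumes ne: "I \<noteq> {}"
    and bdd: "\<And>x. bdd_below ((\<lambda>i. q i x) ` I)"
    and add: "\<And>i j x y. i \<in> I \<Longrightarrow> j \<in> I \<Longrightarrow> \<exists>k\<in>I. q k (x + y) \<le> q i x + q j y"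
    and scale: "\<And>i t x. i \<in> I \<Longrightarrow> 0 < t \<Longrightarrow> \<exists>j\<in>I. q j (t *\<^sub>R x) \<le> t * q i x"
    and zero: "\<And>i. i \<in> I \<Longrightarrow> q i 0 = 0"
  shows "sublinear (\<lambda>x. INF i\<in>I. q i x)"
proof -
  have scale_le: "(INF i\<in>I. q i (t *\<^sub>R x)) \<le> t * (INF i\<in>I. q i x)" if t: "0 < t" for t x
  proof -
    have "(INF i\<in>I. q i (t *\<^sub>R x)) \<le> (INF i\<in>I. t * q i x)"
      by (rule cINF_mono[OF ne bdd]) (use scale t in blast)
    then show ?thesis
      using cINF_mult_left[OF ne bdd t] by simp
  qed
  have "(INF i\<in>I. q i (x + y)) \<le> (INF i\<in>I. q i x) + (INF i\<in>I. q i y)" for x y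
  proof -
    have *: "(INF i\<in>I. q i (x + y)) \<le> q i x + q j y" if ij: "i \<in> I" "j \<in> I" for i j
    proof -
      obtain k where "k \<in> I" "q k (x + y) \<le> q i x + q j y"
        using add[OF ij] by blast
      then show ?thesis
        using cINF_lower[OF bdd, of k "x + y"] by linarith
    qed
    have "(INF i\<in>I. q i (x + y)) - (INF i\<in>I. q i y) \<le> q i x" if i: "i \<in> I" for i
    proof -
      have "(INF i\<in>I. q i (x + y)) - q i x \<le> (INF i\<in>I. q i y)"
        by (rule cINF_greatest[OF ne]) (use *[OF i] in \<open>force simp: algebra_simps\<close>)
      then show ?thesis by linarith
    qed
    then have "(INF i\<in>I. q i (x + y)) - (INF i\<in>I. q i y) \<le> (INF i\<in>I. q i x)"
      by (intro cINF_greatest ne)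
    then show ?thesis by linarith
  qed
  moreover have "(INF i\<in>I. q i (t *\<^sub>R x)) = t * (INF i\<in>I. q i x)" if "0 \<le> t" for t x
  proof (cases "t = 0")
    case True
    then show ?thesis using ne zero by simp
  next
    case False
    then have t: "0 < t" using that by simp
    \<comment> \<open>The reverse inequality is \<open>scale_le\<close> with factor
      \<open>1 / t\<close> at the point \<open>t *\<^sub>R x\<close>.\<close>
    have "(INF i\<in>I. q i ((1 / t) *\<^sub>R (t *\<^sub>R x))) \<le> (1 / t) * (INF i\<in>I. q i (t *\<^sub>R x))"
      by (rule scale_le) (use t in simp)
    then have "t * (INF i\<in>I. q i x) \<le> (INF i\<in>I. q i (t *\<^sub>R x))"
      using t by (simp add: field_simps)
    then show ?thesis using scale_le[OF t, of x] by linarith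
  qed
  ultimately show ?thesis unfolding sublinear_def by blast
qed

text \<open>Pushing a sublinear functional down in the direction \<open>z\<close> bounds its value by \<open>- p z\<close> at \<open>- z\<close>;
  a functional that cannot be pushed down in any direction is therefore linear.\<close>

lemma sublinear_push_down:
  assumes p: "sublinear p"
  obtains q where "sublinear q" "q \<le> p" "\<And>x. q x \<le> p (x + z) - p z"
proof -
  have add: "p (x + y) \<le> p x + p y" for x y
    using p unfolding sublinear_def by blast
  have hom: "0 \<le> t \<Longrightarrow> p (t *\<^sub>R x) = t * p x" for t x
    using p unfolding sublinear_def by blast
  \<comment> \<open>The parameter \<open>t = 0\<close> returns \<open>p\<close> and
    \<open>t = 1\<close> gives the required bound; taking all \<open>t \<ge> 0\<close> makes the
    family closed under the sums and rescalings that \<open>sublinear_INF\<close> asks for.\<close>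
  define r where "r = (\<lambda>t x. p (x + t *\<^sub>R z) - t * p z)"
  define q where "q = (\<lambda>x. INF t\<in>{0..}. r t x)"
  have lower: "- p (- x) \<le> r t x" if "0 \<le> t" for t x
    using add[of "x + t *\<^sub>R z" "- x"] hom[OF that, of z] unfolding r_def by simp
  have bdd: "bdd_below ((\<lambda>t. r t x) ` {0..})" for x
    by (rule bdd_belowI2[where m = "- p (- x)"]) (use lower in simp)
  have "sublinear q"
    unfolding q_def
  proof (rule sublinear_INF[OF _ bdd])
    fix s t :: real and x y
    assume "s \<in> {0..}" "t \<in> {0..}"
    then have "s + t \<in> {0..}" "r (s + t) (x + y) \<le> r s x + r t y"
      using add[of "x + s *\<^sub>R z" "y + t *\<^sub>R z"] unfolding r_def by (auto simp: algebra_simps)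
    then show "\<exists>k\<in>{0..}. r k (x + y) \<le> r s x + r t y" by blast
  next
    fix s t :: real and x
    assume "s \<in> {0..}" "0 < t"
    then have "t * s \<in> {0..}" "r (t * s) (t *\<^sub>R x) \<le> t * r s x"
      using hom[of t "x + s *\<^sub>R z"] unfolding r_def by (auto simp: algebra_simps)
    then show "\<exists>j\<in>{0..}. r j (t *\<^sub>R x) \<le> t * r s x" by blast
  qed (use hom in \<open>auto simp: r_def\<close>)
  moreover have "q x \<le> r t x" if "0 \<le> t" for t x
    unfolding q_def by (rule cINF_lower[OF bdd]) (use that in simp)
  from this[of 0] this[of 1] have "q \<le> p" "\<And>x. q x \<le> p (x + z) - p z"
    by (auto simp: r_def le_fun_def)
  ultimately show ?thesis by (rule that)
qed

lemma linear_of_minimal_sublinear: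
  assumes m: "sublinear m" and min: "\<And>q. sublinear q \<Longrightarrow> q \<le> m \<Longrightarrow> q = m"
  shows "linear m"
proof -
  have super: "m x + m z \<le> m (x + z)" for x z
  proof -
    obtain q where "sublinear q" "q \<le> m" "\<And>x. q x \<le> m (x + z) - m z"
      using sublinear_push_down[OF m] by blast
    \<comment> \<open>By minimality \<open>q\<close> is \<open>m\<close> itself, so its defining
      bound reads as superadditivity of \<open>m\<close>.\<close>
    then show ?thesis using min[of q] by (simp add: le_diff_eq)
  qed
  have add: "m (x + z) = m x + m z" for x z
    using super[of x z] m unfolding sublinear_def by (metis order_antisym)
  have neg: "m (- x) = - m x" for x
    using add[of x "- x"] sublinear_zero[OF m] by simp
  have pos: "0 \<le> t \<Longrightarrow> m (t *\<^sub>R x) = t * m x" for t x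
    using m unfolding sublinear_def by blast
  have "m (t *\<^sub>R x) = t * m x" for t x
  proof (cases "0 \<le> t")
    case False
    then show ?thesis
      using pos[of "- t" x] neg[of "t *\<^sub>R x"] by simp
  qed (rule pos)
  with add show ?thesis by (intro linearI) auto
qed

text \<open>Zorn's lemma with the order reversed yields a minimal sublinear functional below
  \<open>p\<close>, and minimality forces linearity.\<close>

lemma sublinear_dominates_linear:
  assumes p: "sublinear p"
  obtains f where "linear f" "f \<le> p"
proof -
  define A where "A = {q. sublinear q \<and> q \<le> p}"
  let ?R = "relation_of (\<lambda>q r. r \<le> q) A"
  have "\<exists>m\<in>A. \<forall>a\<in>A. a \<le> m \<longrightarrow> a = m"
  proof (rule predicate_Zorn)
    show "partial_order_on A ?R"
      by (rule partial_order_on_relation_ofI) auto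
  next
    fix C assume C: "C \<in> Chains ?R"
    then have CA: "C \<subseteq> A"
      unfolding Chains_def relation_of_def by blast
    have total: "q \<le> r \<or> r \<le> q" if "q \<in> C" "r \<in> C" for q r
      using C that unfolding Chains_def relation_of_def by blast
    show "\<exists>u\<in>A. \<forall>a\<in>C. u \<le> a"
    \<comment> \<open>The empty chain is bounded by \<open>p\<close>, a nonempty one by its
      pointwise infimum.\<close>
    proof (cases "C = {}")
      case True
      then show ?thesis using p unfolding A_def by auto
    next
      case False
      define u where "u = (\<lambda>x. INF q\<in>C. q x)"
      have sub: "sublinear q" "q x \<le> p x" if "q \<in> C" for q x
        using that CA by (auto simp: A_def le_fun_def)
      have bdd: "bdd_below ((\<lambda>q. q x) ` C)" for x
      proof (rule bdd_belowI2)
        fix q assume q: "q \<in> C"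
        show "- p (- x) \<le> q x"
          using sublinear_ge_neg[OF sub(1)[OF q], of x] sub(2)[OF q, of "- x"] by linarith
      qed
      have "sublinear u"
        unfolding u_def
      proof (rule sublinear_INF[OF False bdd])
        fix q r x y assume qr: "q \<in> C" "r \<in> C"
        show "\<exists>k\<in>C. k (x + y) \<le> q x + r y"
        \<comment> \<open>Members of a chain are comparable, and the smaller of \<open>q\<close> and
          \<open>r\<close> serves as \<open>k\<close>.\<close>
        proof (cases "q \<le> r")
          case True
          then have "q (x + y) \<le> q x + r y"
            using sub(1)[OF qr(1)] unfolding sublinear_def le_fun_def
            by (meson add_left_mono order_trans)
          with qr show ?thesis by blast
        next
          case False
          then have "r \<le> q" using total[OF qr] by blast
          then have "r (x + y) \<le> q x + r y"
            using sub(1)[OF qr(2)] unfolding sublinear_def le_fun_def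
            by (meson add_right_mono order_trans)
          with qr show ?thesis by blast
        qed
      next
        fix q :: "'a \<Rightarrow> real" and t :: real and x
        assume "q \<in> C" "0 < t"
        then have "q (t *\<^sub>R x) = t * q x"
          using sub(1)[of q] by (simp add: sublinear_def)
        with \<open>q \<in> C\<close> show "\<exists>j\<in>C. j (t *\<^sub>R x) \<le> t * q x"
          by (metis order_refl)
      qed (use sub(1) sublinear_zero in blast)
      moreover have u_le: "u \<le> q" if "q \<in> C" for q
        unfolding u_def le_fun_def by (intro allI cINF_lower bdd that)
      moreover have "u \<le> p"
        using False u_le CA by (auto simp: A_def intro: order_trans)
      ultimately show ?thesis unfolding A_def by blast
    qed
  qed
  then obtain m where m: "m \<in> A" "\<And>a. a \<in> A \<Longrightarrow> a \<le> m \<Longrightarrow> a = m" by blast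
  have "linear m"
  proof (rule linear_of_minimal_sublinear)
    show "sublinear m" using m(1) unfolding A_def by simp
    show "q = m" if "sublinear q" "q \<le> m" for q
      using m that unfolding A_def by (auto intro: order_trans)
  qed
  then show ?thesis using m(1) that unfolding A_def by blast
qed

text \<open>Pushing the norm down along \<open>z\<close> gives \<open>q\<close> with
  \<open>q (- z) \<le> - norm z\<close>; a linear \<open>f\<close> below \<open>q\<close> then has
  \<open>f z \<ge> norm z\<close>, while \<open>q \<le> norm\<close> gives the other bound.\<close>

lemma real_norming_functional:
  fixes z :: "'a::real_normed_vector"
  obtains f :: "'a \<Rightarrow> real" where "linear f" "\<And>x. f x \<le> norm x" "f z = norm z"
proof -
  have "sublinear (norm :: 'a \<Rightarrow> real)"
    unfolding sublinear_def by (auto intro: norm_triangle_ineq)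
  then obtain q where q: "sublinear q" "q \<le> norm" "\<And>x. q x \<le> norm (x + z) - norm z"
    using sublinear_push_down[where z = z] by blast
  then obtain f where f: "linear f" "f \<le> q"
    using sublinear_dominates_linear by blast
  have le: "f x \<le> norm x" for x
    using f(2) q(2) by (auto simp: le_fun_def intro: order_trans)
  have "f (- z) \<le> q (- z)" using f(2) by (simp add: le_fun_def)
  also have "\<dots> \<le> - norm z" using q(3)[of "- z"] by simp
  finally have "norm z \<le> f z" using linear_neg[OF f(1), of z] by simp
  with le[of z] have "f z = norm z" by simp
  with f(1) le show ?thesis by (rule that)
qed

subsection \<open>Binomial sums and roots of unity\<close>

text \<open>A polynomial factor is lost under n-th roots: if \<open>v < u\<close>, then dividing by
  \<open>u ^ n\<close> leaves \<open>1\<close> below a sequence that tends to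
  \<open>0\<close>.\<close>

lemma le_of_power_le_linear:
  fixes u v C :: real
  assumes "0 \<le> u" "0 \<le> v" and le: "\<And>n::nat. u ^ n \<le> C * (real n + 1) * v ^ n"
  shows "u \<le> v"
proof (rule ccontr)
  assume "\<not> u \<le> v"
  then have uv: "v < u" by simp
  then have u: "0 < u" using assms by linarith
  define w where "w = v / u"
  have w: "norm w < 1" using assms uv u by (simp add: w_def)
  have lim: "(\<lambda>n. C * (real n * w ^ n + w ^ n)) \<longlonglongrightarrow> C * (0 + 0)"
    by (intro tendsto_intros powser_times_n_limit_0[OF w, simplified] LIMSEQ_power_zero w)
  have "1 \<le> C * (real n * w ^ n + w ^ n)" for n
    using le[of n] u by (simp add: w_def power_divide field_simps)
  then have "1 \<le> C * (0 + 0)"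
    by (intro LIMSEQ_le_const[OF lim]) auto
  then show False by simp
qed

text \<open>Since \<open>1\<close> commutes with \<open>x\<close>, the binomial expansion holds in a
  noncommutative ring as well.\<close>

lemma binomial_one_plus:
  fixes x :: "'a::ring_1"
  shows "(1 + x) ^ n = (\<Sum>k\<le>n. of_nat (n choose k) * x ^ k)"
proof (induction n)
  case (Suc n)
  have "(\<Sum>k\<le>Suc n. of_nat (Suc n choose k) * x ^ k)
      = 1 + (\<Sum>k\<le>n. of_nat (Suc n choose Suc k) * x ^ Suc k)"
    by (subst sum.atMost_Suc_shift) simp
  also have "\<dots> = (1 + (\<Sum>k\<le>n. of_nat (n choose Suc k) * x ^ Suc k))
      + (\<Sum>k\<le>n. of_nat (n choose k) * x ^ Suc k)"
    by (simp add: sum.distrib algebra_simps)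
  also have "1 + (\<Sum>k\<le>n. of_nat (n choose Suc k) * x ^ Suc k)
      = (\<Sum>k\<le>Suc n. of_nat (n choose k) * x ^ k)"
    by (subst sum.atMost_Suc_shift) simp
  also have "\<dots> = (1 + x) ^ n"
    using Suc by (simp add: binomial_eq_0)
  also have "(\<Sum>k\<le>n. of_nat (n choose k) * x ^ Suc k) = (1 + x) ^ n * x"
    unfolding Suc sum_distrib_right power_Suc2 by (simp add: mult.assoc)
  finally show ?case by (simp add: power_Suc2 algebra_simps del: power_Suc)
qed simp

text \<open>The sum is geometric with a ratio that is an \<open>m\<close>-th root of unity; as
  \<open>k\<close> and \<open>n\<close> are below \<open>m\<close>, the ratio is \<open>1\<close>
  only for \<open>k = n\<close>.\<close>

lemma roots_of_unity_orthogonal: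
  fixes k n m :: nat
  assumes "k < m" "n < m"
  shows "(\<Sum>j<m. cnj (cis (2 * pi * real j / real m)) ^ n * cis (2 * pi * real j / real m) ^ k)
    = (if k = n then of_nat m else 0)"
proof -
  define w where "w = (\<lambda>j. cis (2 * pi * real j / real m))"
  define z where "z = cnj (w n) * w k"
  \<comment> \<open>Both sides are \<open>cis\<close> of the angle
    \<open>2 * pi * j * (k - n) / m\<close>, which exchanges the roles of base and exponent.\<close>
  have swap: "cnj (w j) ^ n * w j ^ k = z ^ j" for j
    unfolding z_def w_def cis_cnj cis_mult Complex.DeMoivre
    by (rule arg_cong[of _ _ cis]) (simp add: algebra_simps)
  have unit: "cnj (w j) * w j = 1" for j
    by (simp add: w_def cis_cnj cis_mult)
  have root: "w j ^ m = 1" for j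
    using assms by (simp add: w_def Complex.DeMoivre)
  have "(\<Sum>j<m. z ^ j) = (if k = n then of_nat m else 0)"
  proof (cases "k = n")
    case True
    then show ?thesis by (simp add: z_def unit)
  next
    case False
    have "inj_on w {..<m}"
      using Complex.bij_betw_roots_unity[of m] assms unfolding w_def by (auto simp: bij_betw_def)
    then have "w k \<noteq> w n" using assms False by (auto dest: inj_onD)
    moreover have "w n * z = w k"
      unfolding z_def by (metis mult.assoc mult.commute mult_1 unit)
    ultimately have "z \<noteq> 1" by auto
    moreover have "z ^ m = 1"
      by (simp add: z_def power_mult_distrib root flip: complex_cnj_power)
    ultimately show ?thesis using False by (simp add: geometric_sum)
  qed
  then show ?thesis using swap unfolding w_def by simp
qed

subsection \<open>Norms of self-adjoint elements\<close>

lemma scaleC_zero_right [simp]: "c *\<^sub>C (0::'a::cstar_algebra_1) = 0"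
  using scaleC_add_right[of c "0::'a" 0] by simp

lemma scaleC_zero_left [simp]: "0 *\<^sub>C x = (0::'a::cstar_algebra_1)"
  using scaleC_of_real[of 0 x] by simp

lemma scaleC_minus_left: "(- c) *\<^sub>C x = - (c *\<^sub>C (x::'a::cstar_algebra_1))"
  using scaleC_add_left[of c "- c" x] by (simp add: eq_neg_iff_add_eq_0 add.commute)

lemma scaleC_minus_right: "c *\<^sub>C (- x) = - (c *\<^sub>C (x::'a::cstar_algebra_1))"
  using scaleC_add_right[of c x "- x"] by (simp add: eq_neg_iff_add_eq_0 add.commute)

lemma scaleC_sum_right: "c *\<^sub>C (\<Sum>i\<in>I. f i) = (\<Sum>i\<in>I. c *\<^sub>C (f i :: 'a::cstar_algebra_1))"
  by (induction I rule: infinite_finite_induct) (simp_all add: scaleC_add_right)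

lemma scaleC_sum_left: "(\<Sum>i\<in>I. c i) *\<^sub>C x = (\<Sum>i\<in>I. c i *\<^sub>C (x :: 'a::cstar_algebra_1))"
  by (induction I rule: infinite_finite_induct) (simp_all add: scaleC_add_left)

lemma scaleC_of_nat: "of_nat n *\<^sub>C x = of_nat n * (x :: 'a::cstar_algebra_1)"
  using scaleC_of_real[of "of_nat n" x] by (simp add: scaleR_conv_of_real)

lemma scaleC_power: "(c *\<^sub>C x) ^ n = c ^ n *\<^sub>C ((x :: 'a::cstar_algebra_1) ^ n)"
  by (induction n)
    (simp_all add: scaleC_one mult_scaleC_left mult_scaleC_right scaleC_scaleC mult.commute)

lemma star_one [simp]: "star (1::'a::cstar_algebra_1) = 1"
  using star_mult[of 1 "star (1::'a)"] by (simp add: star_star)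

lemma star_scaleR: "star (r *\<^sub>R x) = r *\<^sub>R star (x::'a::cstar_algebra_1)"
  by (simp add: star_scaleC flip: scaleC_of_real)

lemma star_minus: "star (- x) = - star (x::'a::cstar_algebra_1)"
  using star_scaleR[of "-1" x] by simp

lemma star_power: "star (x ^ n) = star (x::'a::cstar_algebra_1) ^ n"
  by (induction n) (simp_all add: star_mult power_commutes)

lemma norm_star [simp]: "norm (star x) = norm (x::'a::cstar_algebra_1)"
proof -
  have le: "norm y \<le> norm (star y)" for y :: 'a
  proof (cases "y = 0")
    case False
    have "norm y * norm y \<le> norm (star y) * norm y"
      using norm_mult_ineq[of "star y" y] cstar_identity[of y] by (simp add: power2_eq_square)
    then show ?thesis using False by simp
  qed simp
  from le[of x] le[of "star x"] show ?thesis by (simp add: star_star)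
qed

lemma norm_square_selfadjoint:
  fixes h :: "'a::cstar_algebra_1"
  assumes "star h = h"
  shows "norm (h\<^sup>2) = (norm h)\<^sup>2"
  using cstar_identity[of h] assms by (simp add: power2_eq_square)

text \<open>The C*-identity doubles exponents and so settles powers of two. A general
  \<open>n\<close> is padded up to \<open>2 ^ n\<close>, and submultiplicativity of the norm leaves
  no room for a loss in the factor \<open>h ^ n\<close>.\<close>

lemma norm_power_selfadjoint:
  fixes h :: "'a::cstar_algebra_1"
  assumes h: "star h = h"
  shows "norm (h ^ n) = norm h ^ n"
proof (cases "h = 0")
  case False
  have pow2: "norm (h ^ (2 ^ k)) = norm h ^ (2 ^ k)" for k
  proof (induction k)
    case (Suc k)
    have "h ^ (2 ^ Suc k) = (h ^ (2 ^ k))\<^sup>2" "norm h ^ (2 ^ Suc k) = (norm h ^ (2 ^ k))\<^sup>2"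
      by (simp_all only: power_mult [symmetric] power_Suc2)
    then show ?case
      using norm_square_selfadjoint[of "h ^ (2 ^ k)"] Suc by (simp add: star_power h)
  qed simp
  have "n \<le> 2 ^ n" by (rule less_imp_le) (rule less_exp)
  then have split: "2 ^ n = n + (2 ^ n - n)" by simp
  have "norm h ^ n * norm h ^ (2 ^ n - n) = norm (h ^ n * h ^ (2 ^ n - n))"
    using pow2[of n] split by (metis power_add)
  also have "\<dots> \<le> norm (h ^ n) * norm h ^ (2 ^ n - n)"
    by (rule order_trans[OF norm_mult_ineq]) (intro mult_left_mono norm_power_ineq norm_ge_zero)
  finally have "norm h ^ n \<le> norm (h ^ n)"
    using False by (simp add: mult_le_cancel_right)
  with norm_power_ineq[of h n] show ?thesis by simp
qed (simp add: power_0_left)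

text \<open>The crux of the existence of norming states, obtained without spectral theory: if \<open>M\<close> denotes
  the maximum, then \<open>norm (1 + \<omega> h) \<le> M\<close> for every unimodular \<open>\<omega>\<close>, so averaging over roots of
  unity bounds every term of the binomial expansion of \<open>(1 + norm h) ^ N\<close> by \<open>M ^ N\<close>.\<close>

lemma norm_one_plus_selfadjoint:
  fixes h :: "'a::cstar_algebra_1"
  assumes h: "star h = h"
  shows "max (norm (1 + h)) (norm (1 - h)) = 1 + norm h"
proof (rule antisym)
  show "max (norm (1 + h)) (norm (1 - h)) \<le> 1 + norm h"
    using norm_triangle_ineq[of 1 h] norm_triangle_ineq4[of 1 h] by simp
next
  define M where "M = max (norm (1 + h)) (norm (1 - h))"
  have M0: "0 \<le> M" by (simp add: M_def le_max_iff_disj)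
  have sq: "norm ((1 + h)\<^sup>2) \<le> M\<^sup>2" "norm ((1 - h)\<^sup>2) \<le> M\<^sup>2"
    by (rule order_trans[OF norm_power_ineq], rule power_mono; simp add: M_def)+
  have circle: "norm (1 + w *\<^sub>C h) \<le> M" if w: "cmod w = 1" for w
  proof -
    define c where "c = Re w"
    have c: "\<bar>c\<bar> \<le> 1" using abs_Re_le_cmod[of w] w by (simp add: c_def)
    have "star (1 + w *\<^sub>C h) * (1 + w *\<^sub>C h) = 1 + (w + cnj w) *\<^sub>C h + (cnj w * w) *\<^sub>C (h * h)"
      by (simp add: star_add star_scaleC h algebra_simps mult_scaleC_left mult_scaleC_right
          scaleC_scaleC scaleC_add_left scaleC_add_right)
    also have "\<dots> = 1 + (2 * c) *\<^sub>R h + h * h"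
      using w by (simp add: complex_add_cnj c_def mult.commute[of "cnj w"] complex_norm_square[symmetric]
          scaleC_one scaleC_of_real[symmetric])
    \<comment> \<open>As \<open>\<bar>c\<bar> \<le> 1\<close>, this is a convex combination of two
      squares of norm at most \<open>M\<^sup>2\<close>, so by the C*-identity the whole circle is
      controlled by its points \<open>1\<close> and \<open>-1\<close>.\<close>
    also have "\<dots> = ((1 + c) / 2) *\<^sub>R (1 + h)\<^sup>2 + ((1 - c) / 2) *\<^sub>R (1 - h)\<^sup>2"
    proof -
      have e: "(1 + h)\<^sup>2 = (1 + h * h) + 2 *\<^sub>R h" "(1 - h)\<^sup>2 = (1 + h * h) - 2 *\<^sub>R h"
        by (simp_all add: power2_eq_square algebra_simps scaleR_2)
      have "((1 + c) / 2) *\<^sub>R (1 + h)\<^sup>2 = ((1 + c) / 2) *\<^sub>R (1 + h * h) + (1 + c) *\<^sub>R h"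
        "((1 - c) / 2) *\<^sub>R (1 - h)\<^sup>2 = ((1 - c) / 2) *\<^sub>R (1 + h * h) - (1 - c) *\<^sub>R h"
        unfolding e by (simp_all only: scaleR_add_right[of _ "1 + h * h"] scaleR_diff_right scaleR_scaleR) simp_all
      moreover have "((1 + c) / 2) *\<^sub>R (1 + h * h) + ((1 - c) / 2) *\<^sub>R (1 + h * h) = 1 + h * h"
        by (simp add: field_simps flip: scaleR_add_left)
      moreover have "(1 + c) *\<^sub>R h - (1 - c) *\<^sub>R h = (2 * c) *\<^sub>R h"
        by (simp flip: scaleR_diff_left)
      moreover have "a + b = p + d" if "a = p\<^sub>1 + u" "b = p\<^sub>2 - w" "p\<^sub>1 + p\<^sub>2 = p" "u - w = d"
        for a b p d p\<^sub>1 p\<^sub>2 u w :: 'a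
        using that by auto
      ultimately have "((1 + c) / 2) *\<^sub>R (1 + h)\<^sup>2 + ((1 - c) / 2) *\<^sub>R (1 - h)\<^sup>2
          = (1 + h * h) + (2 * c) *\<^sub>R h"
        by blast
      then show ?thesis by (simp add: add_ac)
    qed
    finally have "(norm (1 + w *\<^sub>C h))\<^sup>2 = norm (((1 + c) / 2) *\<^sub>R (1 + h)\<^sup>2 + ((1 - c) / 2) *\<^sub>R (1 - h)\<^sup>2)"
      by (simp flip: cstar_identity)
    also have "\<dots> \<le> (1 + c) / 2 * norm ((1 + h)\<^sup>2) + (1 - c) / 2 * norm ((1 - h)\<^sup>2)"
      by (rule order_trans[OF norm_triangle_ineq]) (use c in simp)
    also have "\<dots> \<le> (1 + c) / 2 * M\<^sup>2 + (1 - c) / 2 * M\<^sup>2"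
      by (intro add_mono mult_left_mono sq) (use c in auto)
    also have "\<dots> = M\<^sup>2" by (simp add: field_simps)
    finally show ?thesis using M0 by (rule power2_le_imp_le)
  qed
  have term_le: "real (N choose n) * norm h ^ n \<le> M ^ N" if n: "n \<le> N" for n N
  proof -
    \<comment> \<open>There are \<open>N + 1\<close> roots, enough to separate the exponents
      \<open>0\<close> to \<open>N\<close>; weighting by \<open>cnj (w j) ^ n\<close> isolates the
      term with \<open>h ^ n\<close>.\<close>
    define w where "w = (\<lambda>j. cis (2 * pi * real j / real (Suc N)))"
    have "(\<Sum>j<Suc N. cnj (w j) ^ n *\<^sub>C (1 + w j *\<^sub>C h) ^ N)
        = (\<Sum>j<Suc N. \<Sum>k\<le>N. (of_nat (N choose k) * (cnj (w j) ^ n * w j ^ k)) *\<^sub>C h ^ k)"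
      by (simp add: binomial_one_plus scaleC_sum_right scaleC_power scaleC_of_nat[where 'a='a, symmetric]
          scaleC_scaleC mult_ac del: sum.lessThan_Suc)
    also have "\<dots> = (\<Sum>k\<le>N. (of_nat (N choose k) * (\<Sum>j<Suc N. cnj (w j) ^ n * w j ^ k)) *\<^sub>C h ^ k)"
      by (subst sum.swap) (simp add: scaleC_sum_left sum_distrib_left del: sum.lessThan_Suc)
    also have "\<dots> = (\<Sum>k\<le>N. if k = n then (of_nat (N choose n) * of_nat (Suc N)) *\<^sub>C h ^ n else 0)"
    proof (rule sum.cong[OF refl])
      fix k assume "k \<in> {..N}"
      then have "(\<Sum>j<Suc N. cnj (w j) ^ n * w j ^ k) = (if k = n then of_nat (Suc N) else 0)"
        using n unfolding w_def by (intro roots_of_unity_orthogonal) auto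
      then show "(of_nat (N choose k) * (\<Sum>j<Suc N. cnj (w j) ^ n * w j ^ k)) *\<^sub>C h ^ k
          = (if k = n then (of_nat (N choose n) * of_nat (Suc N)) *\<^sub>C h ^ n else 0)"
        by (simp del: sum.lessThan_Suc)
    qed
    also have "\<dots> = (of_nat (N choose n) * of_nat (Suc N)) *\<^sub>C h ^ n"
      using n by simp
    finally have "real (Suc N) * (real (N choose n) * norm h ^ n)
        = norm (\<Sum>j<Suc N. cnj (w j) ^ n *\<^sub>C (1 + w j *\<^sub>C h) ^ N)"
      by (simp add: norm_scaleC norm_mult norm_power_selfadjoint[OF h] mult_ac
          del: sum.lessThan_Suc of_nat_Suc)
    also have "\<dots> \<le> (\<Sum>j<Suc N. M ^ N)"
    proof (rule sum_norm_le)
      fix j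
      have "norm ((1 + w j *\<^sub>C h) ^ N) \<le> M ^ N"
        by (rule order_trans[OF norm_power_ineq]) (intro power_mono circle, auto simp: w_def)
      then show "norm (cnj (w j) ^ n *\<^sub>C (1 + w j *\<^sub>C h) ^ N) \<le> M ^ N"
        by (simp add: norm_scaleC norm_power w_def)
    qed
    also have "\<dots> = real (Suc N) * M ^ N" by simp
    finally show ?thesis
      by (simp add: mult_le_cancel_left del: of_nat_Suc)
  qed
  have "1 + norm h \<le> M"
  \<comment> \<open>The expansion of \<open>(1 + norm h) ^ N\<close> has \<open>N + 1\<close> terms,
    each at most \<open>M ^ N\<close>.\<close>
  proof (rule le_of_power_le_linear[where C = 1])
    fix N :: nat
    have "(1 + norm h) ^ N = (\<Sum>n\<le>N. real (N choose n) * norm h ^ n)"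
      by (simp add: binomial_one_plus)
    also have "\<dots> \<le> (\<Sum>n\<le>N. M ^ N)"
      by (intro sum_mono term_le) simp
    finally show "(1 + norm h) ^ N \<le> 1 * (real N + 1) * M ^ N" by (simp add: algebra_simps)
  qed (use M0 in auto)
  then show "1 + norm h \<le> max (norm (1 + h)) (norm (1 - h))" by (simp add: M_def)
qed

subsection \<open>States and the numerical radius\<close>

lemma dual_space_add: "\<phi> \<in> dual_space \<Longrightarrow> \<phi> (x + y) = \<phi> x + \<phi> y"
  by (simp add: dual_space_def linear_simps)

lemma dual_space_scaleC: "\<phi> \<in> dual_space \<Longrightarrow> \<phi> (c *\<^sub>C x) = c * \<phi> x"
  by (simp add: dual_space_def)

lemma states_dual_space: "\<phi> \<in> states \<Longrightarrow> \<phi> \<in> dual_space"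
  by (simp add: states_def)

lemma states_norm_le: "\<phi> \<in> states \<Longrightarrow> cmod (\<phi> x) \<le> norm x"
  using onorm[of \<phi> x] by (simp add: states_def dual_space_def)

lemma unimodular_rotation: "exp (\<i> * of_real \<theta>) * z = of_real (cmod z)" if "\<theta> = - Arg z"
  using that rcis_cmod_Arg[of z]
  by (metis cis_conv_exp cis_mult cis_zero add.left_inverse mult.left_commute mult.right_neutral rcis_def)

lemma norm_exp_imaginary [simp]: "cmod (exp (\<i> * of_real \<theta>)) = 1"
  by (simp flip: cis_conv_exp)

text \<open>A complex-linear functional is determined by its real part through
  \<open>\<phi> x = f x - \<i> * f (\<i> *\<^sub>C x)\<close>. Rotating \<open>x\<close> until
  \<open>\<phi> x\<close> is nonnegative carries the bound on \<open>f\<close> over to the modulus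
  of \<open>\<phi>\<close>.\<close>

lemma real_functional_complexify:
  fixes f :: "'a::cstar_algebra_1 \<Rightarrow> real"
  assumes f: "linear f" and le: "\<And>x. f x \<le> norm x" and one: "f 1 = 1"
  obtains \<phi> where "\<phi> \<in> states" "\<And>x. Re (\<phi> x) = f x"
proof -
  interpret f: linear f by (rule f)
  define \<phi> where "\<phi> = (\<lambda>x. Complex (f x) (- f (\<i> *\<^sub>C x)))"
  have i2: "\<i> *\<^sub>C \<i> *\<^sub>C x = - x" for x :: 'a
    by (simp add: scaleC_scaleC scaleC_minus_left scaleC_one)
  have cplx: "\<phi> (c *\<^sub>C x) = c * \<phi> x" for c x
  proof -
    have "c *\<^sub>C x = Re c *\<^sub>R x + Im c *\<^sub>R (\<i> *\<^sub>C x)"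
      by (subst complex_eq[of c])
        (simp add: scaleC_add_left scaleC_of_real[symmetric] scaleC_scaleC mult.commute)
    moreover have "\<i> *\<^sub>C (c *\<^sub>C x) = Re c *\<^sub>R (\<i> *\<^sub>C x) - Im c *\<^sub>R x"
    proof -
      have "\<i> * c = of_real (Re c) * \<i> + of_real (- Im c)" by (simp add: complex_eq_iff)
      then have "\<i> *\<^sub>C (c *\<^sub>C x) = Re c *\<^sub>R (\<i> *\<^sub>C x) + (- Im c) *\<^sub>R x"
        by (simp only: scaleC_scaleC scaleC_add_left scaleC_of_real[symmetric])
      then show ?thesis by simp
    qed
    ultimately have "f (c *\<^sub>C x) = Re c * f x + Im c * f (\<i> *\<^sub>C x)"
      "f (\<i> *\<^sub>C (c *\<^sub>C x)) = Re c * f (\<i> *\<^sub>C x) - Im c * f x"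
      by (simp_all add: f.add f.diff f.scaleR)
    then show ?thesis
      by (simp add: \<phi>_def complex_eq_iff)
  qed
  have norm_le: "cmod (\<phi> x) \<le> norm x" for x
  proof -
    define c where "c = exp (\<i> * of_real (- Arg (\<phi> x)))"
    have "of_real (cmod (\<phi> x)) = \<phi> (c *\<^sub>C x)"
      unfolding cplx c_def by (rule unimodular_rotation[symmetric]) simp
    then have "cmod (\<phi> x) = f (c *\<^sub>C x)"
      by (simp add: \<phi>_def complex_eq_iff)
    also have "\<dots> \<le> norm x"
      using le[of "c *\<^sub>C x"] by (simp only: norm_scaleC c_def norm_exp_imaginary mult_1)
    finally show ?thesis .
  qed
  have add: "\<phi> (x + y) = \<phi> x + \<phi> y" for x y
    by (simp add: \<phi>_def scaleC_add_right f.add complex_eq_iff)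
  have bl: "bounded_linear \<phi>"
  proof (rule bounded_linear_intro[where K = 1])
    show "\<phi> (r *\<^sub>R x) = r *\<^sub>R \<phi> x" for r x
      using cplx[of "of_real r" x] by (simp add: scaleC_of_real scaleR_conv_of_real)
  qed (use add norm_le in auto)
  \<comment> \<open>Modulus at most \<open>1\<close> together with real part \<open>1\<close>
    excludes an imaginary part.\<close>
  have phi_one: "\<phi> 1 = 1"
  proof -
    have "Re (\<phi> 1) = 1" by (simp add: \<phi>_def one)
    moreover have "(cmod (\<phi> 1))\<^sup>2 \<le> 1"
      using norm_le[of 1] by (simp add: power_le_one)
    ultimately show ?thesis by (simp add: cmod_power2 complex_eq_iff)
  qed
  have "onorm \<phi> = 1"
  proof (rule antisym)
    show "onorm \<phi> \<le> 1" by (rule onorm_bound) (use norm_le in auto)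
    show "1 \<le> onorm \<phi>" using onorm[OF bl, of 1] by (simp add: phi_one)
  qed
  then have "\<phi> \<in> states"
    using bl cplx phi_one by (simp add: states_def dual_space_def)
  then show ?thesis by (rule that) (simp add: \<phi>_def)
qed

text \<open>For one choice of sign, \<open>g = h\<close> or \<open>g = - h\<close> satisfies
  \<open>norm (1 + g) = 1 + norm g\<close>. A functional norming \<open>1 + g\<close> must then norm
  \<open>1\<close> and \<open>g\<close> simultaneously; the former makes its complexification a
  state.\<close>

lemma norming_state_selfadjoint:
  fixes h :: "'a::cstar_algebra_1"
  assumes h: "star h = h"
  obtains \<phi> where "\<phi> \<in> states" "norm h \<le> cmod (\<phi> h)"
proof -
  obtain g where g: "g = h \<or> g = - h" "norm (1 + g) = 1 + norm g"
    using norm_one_plus_selfadjoint[OF h] by (metis max_def diff_conv_add_uminus norm_minus_cancel)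
  obtain f :: "'a \<Rightarrow> real" where f: "linear f" "\<And>x. f x \<le> norm x" "f (1 + g) = norm (1 + g)"
    using real_norming_functional by blast
  have "f 1 + f g = 1 + norm g"
    using f(3) g(2) linear_add[OF f(1)] by simp
  with f(2)[of 1] f(2)[of g] have one: "f 1 = 1" and fg: "f g = norm g" by simp_all
  obtain \<phi> where \<phi>: "\<phi> \<in> states" "\<And>x. Re (\<phi> x) = f x"
    using real_functional_complexify[OF f(1,2) one] by blast
  have "f g \<le> \<bar>f h\<bar>"
    using g(1) linear_neg[OF f(1), of h] by auto
  then have "norm h \<le> \<bar>Re (\<phi> h)\<bar>"
    using g(1) fg \<phi>(2) by auto
  also have "\<dots> \<le> cmod (\<phi> h)" by (rule abs_Re_le_cmod)
  finally show ?thesis using \<phi>(1) by (rule that[rotated])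
qed

lemma states_nonempty: "(states :: ('a::cstar_algebra_1 \<Rightarrow> complex) set) \<noteq> {}"
  using norming_state_selfadjoint[of "1::'a"] by (metis empty_iff star_one)

text \<open>The bound \<open>norm (h + i t)\<^sup>2 \<le> (norm h)\<^sup>2 + t\<^sup>2\<close> for every real \<open>t\<close> leaves no room for
  an imaginary part.\<close>

lemma state_selfadjoint_real:
  fixes h :: "'a::cstar_algebra_1"
  assumes \<phi>: "\<phi> \<in> states" and h: "star h = h"
  shows "Im (\<phi> h) = 0"
proof -
  define b where "b = Im (\<phi> h)"
  have ineq: "b\<^sup>2 + 2 * b * t \<le> (norm h)\<^sup>2" for t :: real
  proof -
    define c where "c = \<i> * of_real t"
    have "star (h + c *\<^sub>C 1) * (h + c *\<^sub>C 1) = h * h + (c + cnj c) *\<^sub>C h + (cnj c * c) *\<^sub>C 1"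
      by (simp add: star_add star_scaleC h algebra_simps mult_scaleC_left mult_scaleC_right
          scaleC_scaleC scaleC_add_left scaleC_add_right)
    also have "\<dots> = h * h + (t\<^sup>2) *\<^sub>R 1"
    proof -
      have "c + cnj c = 0" "cnj c * c = of_real (t\<^sup>2)"
        by (simp_all add: c_def power2_eq_square complex_eq_iff)
      then show ?thesis by (simp only: scaleC_of_real) simp
    qed
    finally have "(norm (h + c *\<^sub>C 1))\<^sup>2 = norm (h * h + (t\<^sup>2) *\<^sub>R 1)"
      by (simp flip: cstar_identity)
    also have "\<dots> \<le> (norm h)\<^sup>2 + t\<^sup>2"
      using norm_triangle_ineq[of "h * h" "(t\<^sup>2) *\<^sub>R 1"] norm_mult_ineq[of h h]
      by (simp add: power2_eq_square)
    finally have up: "(norm (h + c *\<^sub>C 1))\<^sup>2 \<le> (norm h)\<^sup>2 + t\<^sup>2" .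
    have "\<phi> (h + c *\<^sub>C 1) = \<phi> h + c"
      using \<phi> dual_space_add[OF states_dual_space[OF \<phi>]] dual_space_scaleC[OF states_dual_space[OF \<phi>]]
      by (simp add: states_def)
    then have "b + t = Im (\<phi> (h + c *\<^sub>C 1))" by (simp add: b_def c_def)
    then have "\<bar>b + t\<bar> \<le> norm (h + c *\<^sub>C 1)"
      using abs_Im_le_cmod states_norm_le[OF \<phi>] order_trans by metis
    then have "(b + t)\<^sup>2 \<le> (norm (h + c *\<^sub>C 1))\<^sup>2"
      by (metis abs_ge_zero power2_abs power_mono)
    with up have "(b + t)\<^sup>2 \<le> (norm h)\<^sup>2 + t\<^sup>2" by linarith
    then show ?thesis by (simp add: power2_sum)
  qed
  have "b = 0"
  proof (rule ccontr)
    assume "b \<noteq> 0"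
    \<comment> \<open>The value of \<open>t\<close> is chosen to make \<open>2 * b * t\<close> equal
      to \<open>(norm h)\<^sup>2 + 1\<close>, just above the allowed bound.\<close>
    then have "b\<^sup>2 + 2 * b * (((norm h)\<^sup>2 + 1) / (2 * b)) = b\<^sup>2 + (norm h)\<^sup>2 + 1" by simp
    with ineq[of "((norm h)\<^sup>2 + 1) / (2 * b)"] show False
      using zero_le_power2[of b] by linarith
  qed
  then show ?thesis by (simp add: b_def)
qed

section \<open>Real and imaginary parts under states\<close>

lemma star_Re_part [simp]: "star (Re_part x) = Re_part (x::'a::cstar_algebra_1)"
  by (simp add: Re_part_def star_scaleC star_add star_star add.commute)

lemma Re_part_add: "Re_part (x + y) = Re_part x + Re_part (y::'a::cstar_algebra_1)"
  by (simp add: Re_part_def star_add scaleC_add_right add_ac)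

lemma Re_Im_part_decomp: "x = Re_part x + \<i> *\<^sub>C Im_part (x::'a::cstar_algebra_1)"
proof -
  have "Re_part x + \<i> *\<^sub>C Im_part x = (1/2 + 1/2) *\<^sub>C x + (1/2 + - (1/2)) *\<^sub>C star x"
    unfolding Re_part_def Im_part_def scaleC_scaleC diff_conv_add_uminus scaleC_add_right scaleC_add_left
    by (simp add: scaleC_minus_right scaleC_minus_left)
  then show ?thesis by (simp add: scaleC_one)
qed

lemma star_Im_part [simp]: "star (Im_part x) = Im_part (x::'a::cstar_algebra_1)"
proof -
  have "star (Im_part x) = (- (1 / (2 * \<i>))) *\<^sub>C (star x + - x)"
    unfolding Im_part_def diff_conv_add_uminus star_scaleC star_add
    using star_scaleC[of "-1" "star x"] by (simp add: scaleC_minus_left scaleC_one star_star)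
  also have "\<dots> = Im_part x"
    unfolding Im_part_def scaleC_minus_left by (simp flip: scaleC_minus_right)
  finally show ?thesis .
qed

text \<open>A state is real on both self-adjoint parts, so the decomposition of \<open>x\<close>
  becomes the Cartesian form of \<open>\<phi> x\<close>.\<close>

lemma state_Re_part:
  fixes x :: "'a::cstar_algebra_1"
  assumes "\<phi> \<in> states"
  shows "\<phi> (Re_part x) = of_real (Re (\<phi> x))"
proof -
  have "\<phi> x = \<phi> (Re_part x) + \<i> * \<phi> (Im_part x)"
    using dual_space_add[OF states_dual_space[OF assms]] dual_space_scaleC[OF states_dual_space[OF assms]]
    by (metis Re_Im_part_decomp)
  moreover have "Im (\<phi> (Re_part x)) = 0" "Im (\<phi> (Im_part x)) = 0"
    using assms by (simp_all add: state_selfadjoint_real)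
  ultimately show ?thesis by (simp add: complex_eq_iff)
qed

section \<open>Numerical radius through rotated real parts\<close>

lemma state_le_numerical_radius: "\<phi> \<in> states \<Longrightarrow> cmod (\<phi> x) \<le> numerical_radius x"
  unfolding numerical_radius_def
  by (rule cSUP_upper) (auto intro!: bdd_aboveI2 states_norm_le)

lemma norm_Re_part_le_numerical_radius:
  "norm (Re_part (exp (\<i> * of_real \<theta>) *\<^sub>C x)) \<le> numerical_radius (x::'a::cstar_algebra_1)"
proof -
  let ?c = "exp (\<i> * of_real \<theta>)"
  obtain \<phi> where \<phi>: "\<phi> \<in> states" "norm (Re_part (?c *\<^sub>C x)) \<le> cmod (\<phi> (Re_part (?c *\<^sub>C x)))"
    using norming_state_selfadjoint[of "Re_part (?c *\<^sub>C x)"] by auto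
  note \<phi>(2)
  also have "cmod (\<phi> (Re_part (?c *\<^sub>C x))) = \<bar>Re (\<phi> (?c *\<^sub>C x))\<bar>"
    by (simp add: state_Re_part[OF \<phi>(1)])
  also have "\<dots> \<le> cmod (\<phi> (?c *\<^sub>C x))" by (rule abs_Re_le_cmod)
  also have "\<dots> = cmod (\<phi> x)"
    by (simp only: dual_space_scaleC[OF states_dual_space[OF \<phi>(1)]] norm_mult norm_exp_imaginary mult_1)
  also have "\<dots> \<le> numerical_radius x" by (rule state_le_numerical_radius[OF \<phi>(1)])
  finally show ?thesis .
qed

lemma numerical_radius_le:
  fixes x :: "'a::cstar_algebra_1"
  assumes "\<And>\<theta>. norm (Re_part (exp (\<i> * of_real \<theta>) *\<^sub>C x)) \<le> B"
  shows "numerical_radius x \<le> B"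
  unfolding numerical_radius_def
proof (rule cSUP_least[OF states_nonempty])
  fix \<phi> :: "'a \<Rightarrow> complex" assume \<phi>: "\<phi> \<in> states"
  let ?c = "exp (\<i> * of_real (- Arg (\<phi> x)))"
  have "\<phi> (?c *\<^sub>C x) = of_real (cmod (\<phi> x))"
    unfolding dual_space_scaleC[OF states_dual_space[OF \<phi>]] by (rule unimodular_rotation) simp
  then have "\<phi> (Re_part (?c *\<^sub>C x)) = of_real (cmod (\<phi> x))"
    by (simp only: state_Re_part[OF \<phi>] Re_complex_of_real)
  then have "cmod (\<phi> x) \<le> norm (Re_part (?c *\<^sub>C x))"
    using states_norm_le[OF \<phi>, of "Re_part (?c *\<^sub>C x)"] by (metis norm_of_real abs_norm_cancel)
  also have "\<dots> \<le> B" by (rule assms)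
  finally show "cmod (\<phi> x) \<le> B" .
qed

section \<open>Norm of a sum of self-adjoint elements\<close>

text \<open>The recursion \<open>X' = a X + Y\<close>, \<open>Y' = b a X + b Y\<close> for \<open>X = (a + b) ^ n\<close>, \<open>Y = b (a + b) ^ n\<close>
  is dominated by the real matrix with rows \<open>(\<alpha>, 1)\<close> and \<open>(\<gamma>, \<beta>)\<close>, which expands the positive
  vector \<open>(1, L - \<alpha>)\<close> at most by the factor \<open>L\<close>.\<close>

lemma norm_add_power_le:
  fixes a b :: "'a::cstar_algebra_1"
  assumes "norm a \<le> \<alpha>" "norm b \<le> \<beta>" "norm (b * a) \<le> \<gamma>"
    and L: "\<alpha> < L" "\<beta> \<le> L" "\<gamma> \<le> (L - \<alpha>) * (L - \<beta>)"
    and C: "1 \<le> C" "norm b \<le> C * (L - \<alpha>)"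
  shows "norm ((a + b) ^ n) \<le> C * L ^ n \<and> norm (b * (a + b) ^ n) \<le> C * (L - \<alpha>) * L ^ n"
proof (induction n)
  case 0
  then show ?case using C by simp
next
  case (Suc n)
  define X where "X = (a + b) ^ n"
  have X: "norm X \<le> C * L ^ n" and Y: "norm (b * X) \<le> C * (L - \<alpha>) * L ^ n"
    using Suc unfolding X_def by auto
  have nn: "0 \<le> \<alpha>" "0 \<le> \<beta>" "0 \<le> \<gamma>"
    using assms(1-3) norm_ge_zero order_trans by blast+
  then have CL: "0 \<le> C * L ^ n" "0 \<le> C * (L - \<alpha>) * L ^ n" using L C by simp_all
  have "norm ((a + b) * X) \<le> norm a * norm X + norm (b * X)"
    using norm_triangle_ineq[of "a * X" "b * X"] norm_mult_ineq[of a X] by (simp add: distrib_right)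
  also have "\<dots> \<le> \<alpha> * (C * L ^ n) + C * (L - \<alpha>) * L ^ n"
    by (intro add_mono mult_mono X Y assms) (use nn in auto)
  finally have 1: "norm ((a + b) * X) \<le> C * L ^ Suc n" by (simp add: algebra_simps)
  \<comment> \<open>Grouping \<open>b * a\<close> before multiplying by \<open>X\<close> brings in
    \<open>\<gamma>\<close> instead of the coarser \<open>\<alpha> * \<beta>\<close>.\<close>
  have "norm (b * ((a + b) * X)) \<le> norm (b * a) * norm X + norm b * norm (b * X)"
    using norm_triangle_ineq[of "b * a * X" "b * (b * X)"] norm_mult_ineq[of "b * a" X]
      norm_mult_ineq[of b "b * X"] by (simp add: distrib_right distrib_left mult.assoc)
  also have "\<dots> \<le> \<gamma> * (C * L ^ n) + \<beta> * (C * (L - \<alpha>) * L ^ n)"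
    by (intro add_mono mult_mono X Y assms) (use nn CL in auto)
  also have "\<dots> \<le> ((L - \<alpha>) * (L - \<beta>)) * (C * L ^ n) + \<beta> * (C * (L - \<alpha>) * L ^ n)"
    by (intro add_mono mult_right_mono L CL) simp
  also have "\<dots> = C * (L - \<alpha>) * L ^ Suc n" by (simp add: algebra_simps)
  finally have "norm (b * ((a + b) * X)) \<le> C * (L - \<alpha>) * L ^ Suc n" .
  with 1 show ?case by (simp add: X_def)
qed

text \<open>The bound is the larger root of
  \<open>(L - \<alpha>) * (L - \<beta>) = \<gamma>\<close>. Every \<open>L\<close> strictly above it
  meets the conditions of the power estimate, and powers of the self-adjoint \<open>a + b\<close>
  turn growth at rate \<open>L\<close> into \<open>norm (a + b) \<le> L\<close>.\<close>

lemma norm_add_selfadjoint_le: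
  fixes a b :: "'a::cstar_algebra_1"
  assumes sa: "star a = a" "star b = b"
    and le: "norm a \<le> \<alpha>" "norm b \<le> \<beta>" "norm (a * b) \<le> \<gamma>"
  shows "norm (a + b) \<le> 1 / 2 * (\<alpha> + \<beta>) + 1 / 2 * sqrt ((\<alpha> - \<beta>)\<^sup>2 + 4 * \<gamma>)"
    (is "_ \<le> ?B")
proof (rule dense_ge)
  fix L assume L: "?B < L"
  have \<gamma>: "0 \<le> \<gamma>" and \<alpha>: "0 \<le> \<alpha>" using le norm_ge_zero order_trans by blast+
  define s where "s = sqrt ((\<alpha> - \<beta>)\<^sup>2 + 4 * \<gamma>)"
  have s2: "s\<^sup>2 = (\<alpha> - \<beta>)\<^sup>2 + 4 * \<gamma>" using \<gamma> by (simp add: s_def)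
  have s: "\<bar>\<alpha> - \<beta>\<bar> \<le> s" using \<gamma> by (simp add: s_def real_le_rsqrt)
  have Ls: "s < 2 * L - \<alpha> - \<beta>" using L[folded s_def] by (simp add: field_simps)
  \<comment> \<open>The point is that \<open>(2 * L - \<alpha> - \<beta>)\<^sup>2 - (\<alpha> -
    \<beta>)\<^sup>2\<close> equals \<open>4 * (L - \<alpha>) * (L - \<beta>)\<close>.\<close>
  have "s\<^sup>2 \<le> (2 * L - \<alpha> - \<beta>)\<^sup>2" using s Ls by (intro power_mono) auto
  then have L\<gamma>: "\<gamma> \<le> (L - \<alpha>) * (L - \<beta>)"
    unfolding s2 by (simp add: power2_eq_square algebra_simps)
  have La: "\<alpha> < L" and Lb: "\<beta> \<le> L" using s Ls by linarith+
  \<comment> \<open>\<open>C\<close> scales \<open>(1, L - \<alpha>)\<close> so that it dominates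
    the initial vector \<open>(1, norm b)\<close>; the strict \<open>\<alpha> < L\<close> keeps the
    quotient meaningful.\<close>
  define C where "C = max 1 (norm b / (L - \<alpha>))"
  have C: "1 \<le> C" "norm b \<le> C * (L - \<alpha>)"
    using La by (auto simp: C_def max_def field_simps)
  \<comment> \<open>The recursion produces \<open>b * a\<close>, the hypothesis speaks of
    \<open>a * b\<close>; the adjoint exchanges them.\<close>
  have "norm (b * a) = norm (star (a * b))" by (simp add: star_mult sa del: norm_star)
  then have ba: "norm (b * a) \<le> \<gamma>" using le(3) by simp
  show "norm (a + b) \<le> L"
  proof (rule le_of_power_le_linear[where C = C])
    fix n :: nat
    have "norm (a + b) ^ n = norm ((a + b) ^ n)"
      by (simp add: norm_power_selfadjoint star_add sa)
    also have "\<dots> \<le> C * L ^ n"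
      using norm_add_power_le[OF le(1,2) ba La Lb L\<gamma> C] by blast
    also have "\<dots> \<le> C * (real n + 1) * L ^ n"
      using C La \<alpha> by (intro mult_right_mono) auto
    finally show "norm (a + b) ^ n \<le> C * (real n + 1) * L ^ n" .
  qed (use La \<alpha> in auto)
qed

text \<open>For each \<theta> the rotated real part of \<open>x + y\<close> splits into two
  self-adjoint summands whose norms are at most \<open>v x\<close> and \<open>v y\<close> and whose
  product has norm at most \<open>S\<close>, so one bound serves all angles.\<close>

lemma numerical_radius_add_le:
  fixes x y :: "'a::cstar_algebra_1"
  defines "v \<equiv> numerical_radius"
    and "S \<equiv> SUP \<theta>::real. norm (Re_part (exp (\<i> * of_real \<theta>) *\<^sub>C x) * Re_part (exp (\<i> * of_real \<theta>) *\<^sub>C y))"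
  defines "B \<equiv> 1 / 2 * (v x + v y) + 1 / 2 * sqrt ((v x - v y)\<^sup>2 + 4 * S)"
  shows "v (x + y) \<le> B \<and> B \<le> v x + v y"
proof
  let ?a = "\<lambda>\<theta>::real. Re_part (exp (\<i> * of_real \<theta>) *\<^sub>C x)"
  let ?b = "\<lambda>\<theta>::real. Re_part (exp (\<i> * of_real \<theta>) *\<^sub>C y)"
  have part_le: "norm (Re_part (exp (\<i> * of_real \<theta>) *\<^sub>C z)) \<le> v z" for \<theta> z
    unfolding v_def by (rule norm_Re_part_le_numerical_radius)
  have v0: "0 \<le> v z" for z
    using part_le[of 0 z] norm_ge_zero order_trans by blast
  have prod: "norm (?a \<theta> * ?b \<theta>) \<le> v x * v y" for \<theta>
    by (rule order_trans[OF norm_mult_ineq])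
      (intro mult_mono part_le v0 norm_ge_zero)
  have S_ge: "norm (?a \<theta> * ?b \<theta>) \<le> S" for \<theta>
    unfolding S_def by (rule cSUP_upper[OF UNIV_I bdd_aboveI2]) (rule prod)
  have S_le: "S \<le> v x * v y"
    unfolding S_def by (rule cSUP_least) (use prod in auto)
  show "v (x + y) \<le> B"
    unfolding v_def
  proof (rule numerical_radius_le)
    fix \<theta> :: real
    show "norm (Re_part (exp (\<i> * of_real \<theta>) *\<^sub>C (x + y))) \<le> B"
      unfolding B_def scaleC_add_right Re_part_add
      by (intro norm_add_selfadjoint_le star_Re_part S_ge part_le)
  qed
  have "sqrt ((v x - v y)\<^sup>2 + 4 * S) \<le> v x + v y"
  proof (rule real_le_lsqrt)
    \<comment> \<open>Replacing \<open>S\<close> by \<open>v x * v y\<close> completes the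
      square.\<close>
    have "(v x - v y)\<^sup>2 + 4 * S \<le> (v x - v y)\<^sup>2 + 4 * (v x * v y)" using S_le by simp
    also have "\<dots> = (v x + v y)\<^sup>2" by (simp add: power2_eq_square algebra_simps)
    finally show "(v x - v y)\<^sup>2 + 4 * S \<le> (v x + v y)\<^sup>2" .
  qed (use v0 in simp)
  then show "B \<le> v x + v y" unfolding B_def by (simp add: field_simps)
qed

text \<open>The imaginary part of an element is the real part of its multiple by
  \<open>- \<i>\<close>, and \<open>- \<i>\<close> is the rotation by
  \<open>- pi / 2\<close>.\<close>

lemma Im_part_eq_Re_part_rotated:
  "Im_part (exp (\<i> * of_real \<theta>) *\<^sub>C x) = Re_part (exp (\<i> * of_real (\<theta> - pi / 2)) *\<^sub>C (x::'a::cstar_algebra_1))"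
proof -
  define c where "c = exp (\<i> * of_real \<theta>)"
  have "exp (\<i> * of_real (\<theta> - pi / 2)) = - \<i> * c"
    unfolding c_def cis_conv_exp[symmetric] by (simp add: cis_mult[symmetric] diff_conv_add_uminus del: add_uminus_conv_diff)
  moreover have "Im_part (c *\<^sub>C x) = Re_part ((- \<i> * c) *\<^sub>C x)"
  proof -
    have "1 / (2 * \<i>) = - (\<i> / 2)" by (simp add: complex_eq_iff)
    then show ?thesis
      unfolding Im_part_def Re_part_def
      by (simp add: diff_conv_add_uminus star_minus star_scaleC scaleC_add_right scaleC_scaleC scaleC_minus_left
          scaleC_minus_right del: add_uminus_conv_diff)
  qed
  ultimately show ?thesis unfolding c_def by simp
qed

theorem theorem2p11:
  fixes x y :: "'a::cstar_algebra_1"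
  shows
    "(let v = numerical_radius;
          S = (SUP \<theta>::real. norm (Re_part (exp (\<i> * of_real \<theta>) *\<^sub>C x) * Re_part (exp (\<i> * of_real \<theta>) *\<^sub>C y)));
          B = 1 / 2 * (v x + v y) + 1 / 2 * sqrt ((v x - v y)\<^sup>2 + 4 * S)
      in v (x + y) \<le> B \<and> B \<le> v x + v y) \<and>
     (let v = numerical_radius;
          S = (SUP \<theta>::real. norm (Im_part (exp (\<i> * of_real \<theta>) *\<^sub>C x) * Im_part (exp (\<i> * of_real \<theta>) *\<^sub>C y)));
          B = 1 / 2 * (v x + v y) + 1 / 2 * sqrt ((v x - v y)\<^sup>2 + 4 * S)
      in v (x + y) \<le> B \<and> B \<le> v x + v y)"
proof -
  define g where "g = (\<lambda>\<theta>::real.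
    norm (Re_part (exp (\<i> * of_real \<theta>) *\<^sub>C x) * Re_part (exp (\<i> * of_real \<theta>) *\<^sub>C y)))"
  \<comment> \<open>A translation permutes the angles, so both suprema run over the same set of
    norms.\<close>
  have "range (\<lambda>\<theta>::real. \<theta> - pi / 2) = UNIV"
    by (rule surjI[of _ "\<lambda>\<theta>. \<theta> + pi / 2"]) simp
  then have "range (\<lambda>\<theta>. g (\<theta> - pi / 2)) = range g"
    by (metis image_image)
  then have "(SUP \<theta>::real. norm (Im_part (exp (\<i> * of_real \<theta>) *\<^sub>C x) * Im_part (exp (\<i> * of_real \<theta>) *\<^sub>C y)))
      = (SUP \<theta>::real. norm (Re_part (exp (\<i> * of_real \<theta>) *\<^sub>C x) * Re_part (exp (\<i> * of_real \<theta>) *\<^sub>C y)))"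
    unfolding Im_part_eq_Re_part_rotated g_def by (rule arg_cong[of _ _ Sup])
  then show ?thesis
    unfolding Let_def using numerical_radius_add_le[of x y] by simp
qed

end
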